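(* Let $q\in(0,\infty)$ and $\gamma\in(0,\infty]$. Let $u\in BMO(\mathbb{R}^N)$ and $k\in[0,\infty)$ be such that $$\|u\|_{BMO(\mathbb{R}^N)}\le k.$$ Then $$k\,\mathcal{L}^N\big(\{x\in \mathbb{R}^N:|u(x)|>k\}\big)^{\frac1q}\approx \left\|\chi_{\{|u|>k\}}u\right\|_{L^{q,\gamma}(\mathbb{R}^N)},$$ where the constants in the equivalence depend only on $\gamma$, $q$ and $N$.
   Context: $N$ is a natural number, $\mathcal{L}^N$ is Lebesgue measure on $\mathbb{R}^N$, and $\chi_E$ is the indicator function of $E$; the convention $0\cdot\infty:=0$ is used. $A\approx B$ means that each of $A$, $B$ is bounded by a positive constant times the other. A cube is a Cartesian product of $N$ non-empty closed bounded intervals of the same length. For real-valued $u\in L^1_{\mathrm{loc}}(\mathbb{R}^N)$, $u\in BMO(\mathbb{R}^N)$ means that $$\|u\|_{BMO(\mathbb{R}^N)}:=\sup\left\{\frac{1}{\mathcal{L}^N(C)^2}\int_C\int_C|u(z)-u(x)|\,dz\,dx : C\subset \mathbb{R}^N\text{ a cube}\right\}<\infty .$$ Lorentz quasi-norms (possibly $+\infty$): for $0<q<\infty$, $$\|f\|_{L^{q,\gamma}(\mathbb{R}^N)}:=\left[\int_0^\infty\big(\mathcal{L}^N(\{x\in \mathbb{R}^N:|f(x)|^q>t\})\big)^{\frac{\gamma}{q}}t^{\frac{\gamma}{q}-1}dt\right]^{1/\gamma}\ (0<\gamma<\infty),$$ $$\|f\|_{L^{q,\infty}(\mathbb{R}^N)}:=\left[\sup_{0<t<\infty}t\,\mathcal{L}^N(\{x\in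 \mathbb{R}^N:|f(x)|^q>t\})\right]^{1/q}.$$
   Formalization: For k = 0 the formal theorem also assumes that {|u|>0} has finite measure; this excludes only nonzero a.e. constant u with k = 0, for which the left side is 0·∞ = 0 and the Lorentz quasi-norm is infinite, so the printed claim fails. *)

theory Defs
  imports "HOL-Analysis.Analysis"
begin

(* Real powers on [0,oo]; meaningful for p > 0 only. *)
definition epowr :: "ennreal \<Rightarrow> real \<Rightarrow> ennreal" where
  "epowr x p = (if x = \<infinity> then \<infinity> else ennreal (enn2real x powr p))"

definition loc_integrable :: "(real ^ 'n \<Rightarrow> real) \<Rightarrow> bool" where
  "loc_integrable u \<longleftrightarrow> (\<forall>K. compact K \<longrightarrow> set_integrable lebesgue K u)"

(* The side length 0 is allowed; it contributes 0 / 0 = 0 to the supremum in bmo_norm. *)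
definition is_cube :: "(real ^ 'n) set \<Rightarrow> bool" where
  "is_cube C \<longleftrightarrow> (\<exists>a l. 0 \<le> l \<and> C = {x. \<forall>i. x $ i \<in> {a $ i .. a $ i + l}})"

definition bmo_norm :: "(real ^ 'n \<Rightarrow> real) \<Rightarrow> ennreal" where
  "bmo_norm u = (SUP C \<in> Collect is_cube.
     (\<integral>\<^sup>+x\<in>C. (\<integral>\<^sup>+z\<in>C. ennreal \<bar>u z - u x\<bar> \<partial>lebesgue) \<partial>lebesgue) / (emeasure lebesgue C)\<^sup>2)"

definition bmo :: "(real ^ 'n \<Rightarrow> real) set" where
  "bmo = {u. loc_integrable u \<and> bmo_norm u < \<infinity>}"

definition lorentz_norm :: "real \<Rightarrow> ennreal \<Rightarrow> (real ^ 'n \<Rightarrow> real) \<Rightarrow> ennreal" where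
  "lorentz_norm q \<gamma> f =
     (if \<gamma> = \<infinity> then
        epowr (SUP t \<in> {0::real<..}. ennreal t * emeasure lebesgue {x. \<bar>f x\<bar> powr q > t}) (1 / q)
      else
        (let g = enn2real \<gamma> in
         epowr (\<integral>\<^sup>+t\<in>{0::real<..}. epowr (emeasure lebesgue {x. \<bar>f x\<bar> powr q > t}) (g / q)
                                     * ennreal (t powr (g / q - 1)) \<partial>lborel) (1 / g)))"

end

theory Submission
  imports Defs
begin

text \<open>
  Let \<open>E = {|u| > s}\<close> have finite measure and \<open>F = {|u| > s + a}\<close>. Take the maximal dyadic cubes in
  which \<open>E\<close> has density greater than \<open>1/2\<close>; up to a null set they cover \<open>E\<close>. In the parent \<open>P\<close> of
  such a cube \<open>E\<close> has density at most \<open>1/2\<close>, and \<open>|u(z) - u(x)| > a\<close> for \<open>x \<in> F\<close>, \<open>z \<notin> E\<close>, so the BMO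
  condition on \<open>P\<close> gives \<open>|P \<inter> F| a |P| / 2 \<le> k |P|\<^sup>2\<close>. Summing over the cubes,
  \<open>|F| \<le> 2 ^ (N + 2) (k / a) |E|\<close>. Iterating \<open>p\<close> times from the level \<open>k\<close> with steps
  \<open>a = (t - k) / p\<close> yields \<open>|{|u| > t}| \<le> C (k / t) ^ p |{|u| > k}|\<close>, and \<open>p \<ge> 2 q\<close> is enough to bound
  the Lorentz quasi-norm. The lower bound only uses that \<open>{|f| ^ q > t} = {|u| > k}\<close> for the truncated
  function \<open>f\<close> and \<open>t < k ^ q\<close>.
\<close>

section \<open>Dyadic cubes\<close>

definition dyadic_cube :: "real \<Rightarrow> nat \<Rightarrow> real ^ 'n \<Rightarrow> (real ^ 'n) set" where
  "dyadic_cube L n x = {y. \<forall>i. \<lfloor>2 ^ n * y $ i / L\<rfloor> = \<lfloor>2 ^ n * x $ i / L\<rfloor>}"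

lemma self_in_dyadic_cube: "x \<in> dyadic_cube L n x"
  by (simp add: dyadic_cube_def)

lemma dyadic_cube_eqI: "y \<in> dyadic_cube L n x \<Longrightarrow> dyadic_cube L n y = dyadic_cube L n x"
  by (simp add: dyadic_cube_def)

lemma dyadic_cube_antimono:
  assumes "m \<le> n"
  shows "dyadic_cube L n x \<subseteq> dyadic_cube L m x"
proof -
  have "\<lfloor>2 ^ m * r / L\<rfloor> = \<lfloor>2 ^ n * r / L\<rfloor> div 2 ^ (n - m)" for r
  proof -
    have "(2::real) ^ n = 2 ^ m * real_of_int (2 ^ (n - m))"
      using assms by (simp flip: power_add)
    then have "2 ^ m * r / L = (2 ^ n * r / L) / real_of_int (2 ^ (n - m))"
      by simp
    then show ?thesis
      by (metis floor_divide_real_eq_div zero_le_numeral zero_le_power)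
  qed
  then show ?thesis
    by (auto simp: dyadic_cube_def)
qed

lemma dyadic_cube_conv_interval:
  fixes n :: nat
  assumes "0 < L"
  defines "l \<equiv> L / 2 ^ n"
  shows "dyadic_cube L n x =
    {y. \<forall>i. l * \<lfloor>2 ^ n * x $ i / L\<rfloor> \<le> y $ i \<and> y $ i < l * \<lfloor>2 ^ n * x $ i / L\<rfloor> + l}"
  using assms(1) unfolding dyadic_cube_def l_def floor_eq_iff
  by (simp add: field_simps)

lemma closed_cube_eq_cbox:
  fixes a :: "real ^ 'n"
  shows "{x. \<forall>i. x $ i \<in> {a $ i .. a $ i + l}} = cbox a (a + (\<chi> i. l))"
  by (auto simp: mem_box_cart)

lemma emeasure_closed_cube:
  fixes a :: "real ^ 'n"
  assumes "0 \<le> l"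
  shows "emeasure lebesgue (cbox a (a + (\<chi> i. l))) = ennreal (l ^ CARD('n))"
proof -
  have "emeasure lborel (cbox a (a + (\<chi> i. l))) = (\<Prod>b\<in>Basis. (\<chi> i. l) \<bullet> (b :: real ^ 'n))"
    using assms by (subst emeasure_lborel_cbox) (auto simp: inner_simps Basis_vec_def inner_axis)
  also have "(\<Prod>b\<in>Basis. (\<chi> i. l) \<bullet> (b :: real ^ 'n)) = (\<Prod>b\<in>(Basis :: (real ^ 'n) set). l)"
    by (intro prod.cong) (auto simp: Basis_vec_def inner_axis)
  finally show ?thesis by simp
qed

lemma emeasure_open_cube:
  fixes a :: "real ^ 'n"
  assumes "0 \<le> l"
  shows "emeasure lebesgue (box a (a + (\<chi> i. l))) = ennreal (l ^ CARD('n))"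
proof -
  have "emeasure lborel (box a (a + (\<chi> i. l))) = (\<Prod>b\<in>Basis. (\<chi> i. l) \<bullet> (b :: real ^ 'n))"
    using assms by (subst emeasure_lborel_box) (auto simp: inner_simps Basis_vec_def inner_axis)
  also have "(\<Prod>b\<in>Basis. (\<chi> i. l) \<bullet> (b :: real ^ 'n)) = (\<Prod>b\<in>(Basis :: (real ^ 'n) set). l)"
    by (intro prod.cong) (auto simp: Basis_vec_def inner_axis)
  finally show ?thesis by simp
qed

lemma sets_dyadic_cube [measurable]: "dyadic_cube L n x \<in> sets lebesgue"
proof -
  have "dyadic_cube L n x \<in> sets borel"
    unfolding dyadic_cube_def by measurable
  then show ?thesis by simp
qed

lemma dyadic_cube_subset_closed_cube:
  fixes x :: "real ^ 'n"
  assumes "0 < L"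
  obtains P where "is_cube P" "P \<in> sets lebesgue" "dyadic_cube L n x \<subseteq> P"
    "emeasure lebesgue P = ennreal ((L / 2 ^ n) ^ CARD('n))"
    "emeasure lebesgue (dyadic_cube L n x) = ennreal ((L / 2 ^ n) ^ CARD('n))"
proof -
  define l where "l = L / 2 ^ n"
  define a where "a = (\<chi> i. l * \<lfloor>2 ^ n * x $ i / L\<rfloor>)"
  have l: "0 \<le> l" using assms by (simp add: l_def)
  define P where "P = cbox a (a + (\<chi> i. l))"
  have D: "dyadic_cube L n x = {y. \<forall>i. a $ i \<le> y $ i \<and> y $ i < a $ i + l}"
    by (simp add: dyadic_cube_conv_interval[OF assms] l_def a_def)
  have 1: "dyadic_cube L n x \<subseteq> P"
    unfolding D P_def by (auto simp: mem_box_cart less_imp_le)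
  have 2: "box a (a + (\<chi> i. l)) \<subseteq> dyadic_cube L n x"
    unfolding D by (auto simp: mem_box_cart less_imp_le)
  have "emeasure lebesgue (dyadic_cube L n x) = ennreal (l ^ CARD('n))"
    using emeasure_mono[OF 1, of lebesgue] emeasure_mono[OF 2, of lebesgue]
      emeasure_closed_cube[OF l, of a] emeasure_open_cube[OF l, of a]
    by (simp add: P_def)
  moreover have "is_cube P"
    unfolding is_cube_def P_def closed_cube_eq_cbox using l by blast
  ultimately show thesis
    using 1 emeasure_closed_cube[OF l, of a] that[of P] by (simp add: P_def l_def)
qed

lemma dyadic_cube_subset_open:
  fixes x :: "real ^ 'n"
  assumes "0 < L" "open U" "x \<in> U"
  obtains n where "dyadic_cube L n x \<subseteq> U"
proof -
  obtain e where e: "0 < e" "ball x e \<subseteq> U"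
    using assms openE by blast
  have "(\<lambda>n. CARD('n) * (L * (1 / 2) ^ n)) \<longlonglongrightarrow> CARD('n) * (L * 0)"
    by (intro tendsto_intros LIMSEQ_realpow_zero) auto
  then have "eventually (\<lambda>n. CARD('n) * (L * (1 / 2) ^ n) < e) sequentially"
    using e(1) by (intro order_tendstoD(2)) auto
  then obtain n where n: "CARD('n) * (L * (1 / 2) ^ n) < e"
    by (auto simp: eventually_sequentially)
  have "y \<in> ball x e" if "y \<in> dyadic_cube L n x" for y
  proof -
    have "\<bar>(x - y) $ i\<bar> \<le> L * (1 / 2) ^ n" for i
      using that self_in_dyadic_cube[of x L n]
      unfolding dyadic_cube_conv_interval[OF assms(1)]
      by (simp add: power_one_over abs_if) (smt (verit, best))
    then have "norm (x - y) \<le> CARD('n) * (L * (1 / 2) ^ n)"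
      using norm_le_l1_cart[of "x - y"] sum_bounded_above[of UNIV "\<lambda>i. \<bar>(x - y) $ i\<bar>"]
      by fastforce
    then show ?thesis using n by (simp add: dist_norm)
  qed
  then show thesis using e that by blast
qed

lemma countable_dyadic_cubes:
  "countable {dyadic_cube L n (x :: real ^ 'n) | n x. P n x}"
proof -
  have "countable (range (\<lambda>(n, z :: 'n \<Rightarrow> int). {y. \<forall>i. \<lfloor>2 ^ n * y $ i / L\<rfloor> = z i}))"
    by simp
  then show ?thesis
  proof (rule countable_subset[rotated])
    show "{dyadic_cube L n x | n x. P n x}
        \<subseteq> range (\<lambda>(n, z :: 'n \<Rightarrow> int). {y. \<forall>i. \<lfloor>2 ^ n * y $ i / L\<rfloor> = z i})"
    proof safe
      fix n and x :: "real ^ 'n"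
      show "dyadic_cube L n x \<in> range (\<lambda>(n, z :: 'n \<Rightarrow> int). {y. \<forall>i. \<lfloor>2 ^ n * y $ i / L\<rfloor> = z i})"
        unfolding dyadic_cube_def
        by (rule range_eqI[where x = "(n, \<lambda>i. \<lfloor>2 ^ n * x $ i / L\<rfloor>)"]) simp
    qed
  qed
qed

lemma emeasure_le_on_maximal_dyadic_cubes:
  fixes A B :: "(real ^ 'n) set" and c :: ennreal
  assumes [measurable]: "A \<in> sets lebesgue" "B \<in> sets lebesgue"
  assumes le: "\<And>n x. \<lbrakk>good (dyadic_cube L n x); \<And>m. m < n \<Longrightarrow> \<not> good (dyadic_cube L m x)\<rbrakk>
      \<Longrightarrow> emeasure lebesgue (B \<inter> dyadic_cube L n x) \<le> c * emeasure lebesgue (A \<inter> dyadic_cube L n x)"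
  defines "G \<equiv> {x. \<exists>n. good (dyadic_cube L n x)}"
  shows "G \<in> sets lebesgue"
    and "emeasure lebesgue (B \<inter> G) \<le> c * emeasure lebesgue (A \<inter> G)"
proof -
  \<comment> \<open>\<open>G\<close> is the disjoint union of its maximal good cubes.\<close>
  define \<Q> where "\<Q> = {dyadic_cube L n x | n x.
    good (dyadic_cube L n x) \<and> (\<forall>m<n. \<not> good (dyadic_cube L m x))}"
  have cnt: "countable \<Q>"
    unfolding \<Q>_def by (rule countable_dyadic_cubes)
  have meas: "Q \<in> sets lebesgue" if "Q \<in> \<Q>" for Q
    using that by (auto simp: \<Q>_def)
  have G: "G = \<Union>\<Q>"
  proof (intro equalityI subsetI)
    fix x assume "x \<in> G"
    define n where "n = (LEAST n. good (dyadic_cube L n x))"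
    have "good (dyadic_cube L n x)" "\<forall>m<n. \<not> good (dyadic_cube L m x)"
      using \<open>x \<in> G\<close> unfolding n_def G_def by (auto intro: LeastI dest: not_less_Least)
    then show "x \<in> \<Union>\<Q>"
      using self_in_dyadic_cube[of x L n] by (auto simp: \<Q>_def)
  next
    fix x assume "x \<in> \<Union>\<Q>"
    then show "x \<in> G"
      by (auto simp: \<Q>_def G_def) (metis dyadic_cube_eqI)
  qed
  have disj: "Q = R" if QR: "Q \<in> \<Q>" "R \<in> \<Q>" "y \<in> Q" "y \<in> R" for Q R y
  proof -
    have *: "\<exists>n. S = dyadic_cube L n y \<and> good (dyadic_cube L n y) \<and> (\<forall>m<n. \<not> good (dyadic_cube L m y))"
      if S: "S \<in> \<Q>" "y \<in> S" for S
    proof -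
      obtain n x where n: "S = dyadic_cube L n x" "good (dyadic_cube L n x)"
        "\<forall>m<n. \<not> good (dyadic_cube L m x)"
        using S by (auto simp: \<Q>_def)
      have "dyadic_cube L m y = dyadic_cube L m x" if "m \<le> n" for m
        using S n(1) dyadic_cube_antimono[OF that, of L x] by (intro dyadic_cube_eqI) auto
      then show ?thesis using n by (metis less_imp_le order_refl)
    qed
    show ?thesis
      using *[OF QR(1,3)] *[OF QR(2,4)] by (metis linorder_neqE_nat)
  qed
  have sum: "emeasure lebesgue (S \<inter> G) = (\<integral>\<^sup>+Q. emeasure lebesgue (S \<inter> Q) \<partial>count_space \<Q>)"
    if [measurable]: "S \<in> sets lebesgue" for S
  proof -
    have "S \<inter> G = (\<Union>Q\<in>\<Q>. S \<inter> Q)" by (auto simp: G)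
    moreover have "disjoint_family_on (\<lambda>Q. S \<inter> Q) \<Q>"
      using disj by (fastforce simp: disjoint_family_on_def)
    ultimately show ?thesis
      using cnt meas by (simp only:) (intro emeasure_UN_countable, auto)
  qed
  show "G \<in> sets lebesgue"
    unfolding G using cnt meas by (intro sets.countable_Union) auto
  have "emeasure lebesgue (B \<inter> G) \<le> (\<integral>\<^sup>+Q. c * emeasure lebesgue (A \<inter> Q) \<partial>count_space \<Q>)"
    unfolding sum[OF assms(2)] using le by (intro nn_integral_mono) (auto simp: \<Q>_def)
  also have "\<dots> = c * emeasure lebesgue (A \<inter> G)"
    by (simp add: nn_integral_cmult sum)
  finally show "emeasure lebesgue (B \<inter> G) \<le> c * emeasure lebesgue (A \<inter> G)" .
qed

lemma ennreal_half_leI: "2 * x \<le> y \<Longrightarrow> x \<le> ennreal (1 / 2) * y"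
proof -
  assume "2 * x \<le> y"
  then have "ennreal (1 / 2) * (2 * x) \<le> ennreal (1 / 2) * y"
    by (rule mult_left_mono) simp
  moreover have "ennreal (1 / 2) * 2 = 1"
    by (subst ennreal_numeral[symmetric], subst ennreal_mult[symmetric]) auto
  ultimately show ?thesis
    by (simp only: mult.assoc[symmetric] mult_1_left)
qed

lemma dyadic_density:
  fixes E :: "(real ^ 'n) set"
  assumes E [measurable]: "E \<in> sets lebesgue" and fin: "emeasure lebesgue E < \<infinity>" and L: "0 < L"
  defines "G \<equiv> {x. \<exists>n. emeasure lebesgue (dyadic_cube L n x) < 2 * emeasure lebesgue (E \<inter> dyadic_cube L n x)}"
  shows "G \<in> sets lebesgue" and "emeasure lebesgue (E - G) = 0"
proof -
  show G [measurable]: "G \<in> sets lebesgue"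
    unfolding G_def
    by (rule emeasure_le_on_maximal_dyadic_cubes(1)[where A = "{}" and B = "{}" and c = 0]) auto
  define K where "K = E - G"
  have K [measurable]: "K \<in> sets lebesgue" by (simp add: K_def)
  have "emeasure lebesgue K \<le> emeasure lebesgue E"
    by (intro emeasure_mono) (auto simp: K_def)
  then obtain r where r: "0 \<le> r" "emeasure lebesgue K = ennreal r"
    using fin by (cases "emeasure lebesgue K") auto
  \<comment> \<open>Every dyadic cube meeting \<open>K\<close> contains at most half of its measure from \<open>K\<close>, so \<open>K\<close> fills at
    most half of any open neighbourhood \<open>U\<close>.\<close>
  have "r \<le> e" if "0 < e" for e
  proof -
    obtain U where U: "open U" "K \<subseteq> U" "emeasure lebesgue (U - K) < ennreal e"
      using sets_lebesgue_outer_open[OF K \<open>0 < e\<close>] by metis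
    have [measurable]: "U \<in> sets lebesgue" using U(1) by auto
    have eq: "{x. \<exists>n. dyadic_cube L n x \<subseteq> U} = U"
      by (auto intro: subsetD[OF _ self_in_dyadic_cube]) (metis dyadic_cube_subset_open[OF L U(1)])
    have "emeasure lebesgue (K \<inter> dyadic_cube L n x)
        \<le> ennreal (1 / 2) * emeasure lebesgue (U \<inter> dyadic_cube L n x)"
      if "dyadic_cube L n x \<subseteq> U" for n x
    proof (cases "K \<inter> dyadic_cube L n x = {}")
      case False
      then obtain y where y: "y \<in> K" "y \<in> dyadic_cube L n x" by auto
      have "2 * emeasure lebesgue (E \<inter> dyadic_cube L n y) \<le> emeasure lebesgue (dyadic_cube L n y)"
        using y(1) by (auto simp: K_def G_def not_less)
      then have *: "2 * emeasure lebesgue (E \<inter> dyadic_cube L n x) \<le> emeasure lebesgue (dyadic_cube L n x)"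
        by (simp add: dyadic_cube_eqI[OF y(2)])
      have "emeasure lebesgue (K \<inter> dyadic_cube L n x) \<le> emeasure lebesgue (E \<inter> dyadic_cube L n x)"
        by (intro emeasure_mono) (auto simp: K_def)
      also have "\<dots> \<le> ennreal (1 / 2) * emeasure lebesgue (dyadic_cube L n x)"
        using * by (rule ennreal_half_leI)
      finally show ?thesis
        using that by (simp add: Int_absorb1)
    qed simp
    then have "emeasure lebesgue (K \<inter> U) \<le> ennreal (1 / 2) * emeasure lebesgue (U \<inter> U)"
      using emeasure_le_on_maximal_dyadic_cubes(2)[of U K "\<lambda>D. D \<subseteq> U" L "ennreal (1 / 2)"]
      unfolding eq by auto
    also have "emeasure lebesgue (U \<inter> U) = emeasure lebesgue K + emeasure lebesgue (U - K)"
      using U(2) by (subst plus_emeasure) (auto simp: Un_absorb1)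
    also have "\<dots> \<le> ennreal (r + e)"
      using r U(3) \<open>0 < e\<close> by (auto intro!: add_left_mono)
    finally have "ennreal r \<le> ennreal (1 / 2) * ennreal (r + e)"
      using U(2) r by (simp add: Int_absorb2 mult_left_mono)
    then have "ennreal r \<le> ennreal (1 / 2 * (r + e))"
      using r \<open>0 < e\<close> by (subst ennreal_mult) auto
    then have "r \<le> 1 / 2 * (r + e)"
      using r \<open>0 < e\<close> by (subst (asm) ennreal_le_iff) auto
    then show ?thesis by simp
  qed
  then have "r \<le> 0" by (rule field_le_epsilon[of r 0, simplified])
  then show "emeasure lebesgue (E - G) = 0"
    using r by (simp add: K_def)
qed

section \<open>Decay of the superlevel sets of BMO functions\<close>

lemma loc_integrable_imp_measurable:
  fixes u :: "real ^ 'n \<Rightarrow> real"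
  assumes "loc_integrable u"
  shows "u \<in> borel_measurable lebesgue"
proof (rule borel_measurable_LIMSEQ_real)
  show "(\<lambda>x. indicator (cball 0 (real n)) x *\<^sub>R u x) \<in> borel_measurable lebesgue" for n
    using assms unfolding loc_integrable_def set_integrable_def by (simp add: borel_measurable_integrable)
  fix x :: "real ^ 'n"
  obtain m :: nat where "norm x \<le> m" using real_arch_simple by blast
  then have "\<forall>n\<ge>m. indicator (cball 0 (real n)) x *\<^sub>R u x = u x" by auto
  then show "(\<lambda>n. indicator (cball 0 (real n)) x *\<^sub>R u x) \<longlonglongrightarrow> u x"
    by (intro tendsto_eventually) (auto simp: eventually_sequentially)
qed

lemma bmo_norm_cube:
  assumes "is_cube C" "emeasure lebesgue C = ennreal V" "0 < V"
  shows "(\<integral>\<^sup>+x\<in>C. (\<integral>\<^sup>+z\<in>C. ennreal \<bar>u z - u x\<bar> \<partial>lebesgue) \<partial>lebesgue) \<le> bmo_norm u * ennreal (V\<^sup>2)"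
proof -
  have "(\<integral>\<^sup>+x\<in>C. (\<integral>\<^sup>+z\<in>C. ennreal \<bar>u z - u x\<bar> \<partial>lebesgue) \<partial>lebesgue) / (emeasure lebesgue C)\<^sup>2 \<le> bmo_norm u"
    unfolding bmo_norm_def using assms(1) by (intro SUP_upper) auto
  then have "(\<integral>\<^sup>+x\<in>C. (\<integral>\<^sup>+z\<in>C. ennreal \<bar>u z - u x\<bar> \<partial>lebesgue) \<partial>lebesgue) / ennreal (V\<^sup>2) * ennreal (V\<^sup>2)
      \<le> bmo_norm u * ennreal (V\<^sup>2)"
    using assms by (intro mult_right_mono) (auto simp: ennreal_power)
  then show ?thesis
    using assms(3) by (simp add: ennreal_divide_times)
qed

lemma bmo_cube_superlevel_le:
  fixes u :: "real ^ 'n \<Rightarrow> real"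
  assumes u: "u \<in> borel_measurable lebesgue" and k: "bmo_norm u \<le> ennreal k" "0 \<le> k" and a: "0 < a"
    and P: "is_cube P" "P \<in> sets lebesgue" "emeasure lebesgue P = ennreal V" "0 < V"
    and half: "2 * emeasure lebesgue ({x. s < \<bar>u x\<bar>} \<inter> P) \<le> ennreal V"
  shows "emeasure lebesgue ({x. s + a < \<bar>u x\<bar>} \<inter> P) \<le> ennreal (2 * k / a * V)"
proof -
  note [measurable] = u P(2)
  define E F where "E = {x. s < \<bar>u x\<bar>}" and "F = {x. s + a < \<bar>u x\<bar>}"
  have "Measurable.pred lebesgue (\<lambda>x. s < \<bar>u x\<bar>)" "Measurable.pred lebesgue (\<lambda>x. s + a < \<bar>u x\<bar>)"
    by measurable
  then have [measurable]: "E \<in> sets lebesgue" "F \<in> sets lebesgue"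
    by (auto simp: E_def F_def pred_def)
  have finP: "emeasure lebesgue S < \<infinity>" if "S \<subseteq> P" for S
  proof -
    have "emeasure lebesgue S \<le> ennreal V"
      using emeasure_mono[OF that P(2)] P(3) by simp
    then show ?thesis by (rule le_less_trans) simp
  qed
  obtain e where e: "0 \<le> e" "emeasure lebesgue (E \<inter> P) = ennreal e"
    using finP[of "E \<inter> P"] by (cases "emeasure lebesgue (E \<inter> P)") auto
  obtain f where f: "0 \<le> f" "emeasure lebesgue (F \<inter> P) = ennreal f"
    using finP[of "F \<inter> P"] by (cases "emeasure lebesgue (F \<inter> P)") auto
  obtain w where w: "0 \<le> w" "emeasure lebesgue (P - E) = ennreal w"
    using finP[of "P - E"] by (cases "emeasure lebesgue (P - E)") auto
  have "2 * e \<le> V"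
  proof -
    have "ennreal (2 * e) \<le> ennreal V"
      using half e by (simp add: E_def ennreal_mult)
    then show ?thesis using P(4) by (subst (asm) ennreal_le_iff) auto
  qed
  moreover have "V = e + w"
  proof -
    have "ennreal V = emeasure lebesgue ((E \<inter> P) \<union> (P - E))"
      using P(3) by (simp only: Int_commute[of E] Int_Diff_Un)
    also have "\<dots> = ennreal (e + w)"
      using e w by (subst plus_emeasure[symmetric]) auto
    finally show ?thesis using P(4) e w by (subst (asm) ennreal_inj) auto
  qed
  ultimately have V: "V / 2 \<le> w" by simp
  have "ennreal (a * w) * emeasure lebesgue (F \<inter> P) = (\<integral>\<^sup>+x. ennreal (a * w) * indicator (F \<inter> P) x \<partial>lebesgue)"
    by (simp add: nn_integral_cmult_indicator)
  also have "\<dots> \<le> (\<integral>\<^sup>+x\<in>P. (\<integral>\<^sup>+z\<in>P. ennreal \<bar>u z - u x\<bar> \<partial>lebesgue) \<partial>lebesgue)"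
  proof (intro nn_integral_mono)
    fix x
    have "ennreal (a * w) \<le> (\<integral>\<^sup>+z\<in>P. ennreal \<bar>u z - u x\<bar> \<partial>lebesgue)" if "x \<in> F"
    proof -
      have "ennreal (a * w) = (\<integral>\<^sup>+z. ennreal a * indicator (P - E) z \<partial>lebesgue)"
        using a w by (simp add: nn_integral_cmult_indicator ennreal_mult)
      also have "\<dots> \<le> (\<integral>\<^sup>+z\<in>P. ennreal \<bar>u z - u x\<bar> \<partial>lebesgue)"
        using that by (intro nn_integral_mono) (auto simp: E_def F_def indicator_def intro!: ennreal_leI)
      finally show ?thesis .
    qed
    then show "ennreal (a * w) * indicator (F \<inter> P) x
        \<le> (\<integral>\<^sup>+z\<in>P. ennreal \<bar>u z - u x\<bar> \<partial>lebesgue) * indicator P x"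
      by (auto simp: indicator_def)
  qed
  also have "\<dots> \<le> bmo_norm u * ennreal (V\<^sup>2)"
    by (rule bmo_norm_cube[OF P(1,3,4)])
  also have "\<dots> \<le> ennreal k * ennreal (V\<^sup>2)"
    by (intro mult_right_mono k(1)) simp
  finally have "ennreal (a * w * f) \<le> ennreal (k * V\<^sup>2)"
    using a w f k by (simp add: ennreal_mult)
  then have *: "a * w * f \<le> k * V\<^sup>2"
    using k by (subst (asm) ennreal_le_iff) auto
  have "a * (V / 2) * f \<le> a * w * f"
    using V a f by (intro mult_right_mono mult_left_mono) auto
  with * have "V * (a * f) \<le> V * (2 * k * V)"
    by (simp add: power2_eq_square algebra_simps)
  then have "a * f \<le> 2 * k * V"
    using P(4) by simp
  then have "f \<le> 2 * k / a * V"
    using a by (simp add: field_simps)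
  then show ?thesis
    using f by (simp add: F_def ennreal_leI)
qed

lemma bmo_superlevel_step:
  fixes u :: "real ^ 'n \<Rightarrow> real"
  assumes u: "u \<in> borel_measurable lebesgue" and k: "bmo_norm u \<le> ennreal k" "0 \<le> k" and a: "0 < a"
    and fin: "emeasure lebesgue {x. s < \<bar>u x\<bar>} < \<infinity>"
  shows "emeasure lebesgue {x. s + a < \<bar>u x\<bar>}
    \<le> ennreal (2 ^ (CARD('n) + 2) * k / a) * emeasure lebesgue {x. s < \<bar>u x\<bar>}"
proof -
  note [measurable] = u
  define E F where "E = {x. s < \<bar>u x\<bar>}" and "F = {x. s + a < \<bar>u x\<bar>}"
  define c where "c = 2 ^ (CARD('n) + 2) * k / a"
  have c: "0 \<le> c" using k a by (simp add: c_def)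
  have "Measurable.pred lebesgue (\<lambda>x. s < \<bar>u x\<bar>)" "Measurable.pred lebesgue (\<lambda>x. s + a < \<bar>u x\<bar>)"
    by measurable
  then have [measurable]: "E \<in> sets lebesgue" "F \<in> sets lebesgue"
    by (auto simp: E_def F_def pred_def)
  obtain e where e: "0 \<le> e" "emeasure lebesgue E = ennreal e"
    using fin by (cases "emeasure lebesgue E") (auto simp: E_def)
  \<comment> \<open>So large that no cube of generation 0 is dense.\<close>
  define L where "L = 1 + 2 * e"
  have L: "0 < L" "2 * e \<le> L ^ CARD('n)"
  proof -
    show "0 < L" using e by (simp add: L_def)
    have "L ^ 1 \<le> L ^ CARD('n)"
      using e by (intro power_increasing) (auto simp: L_def Suc_le_eq)
    then show "2 * e \<le> L ^ CARD('n)" by (simp add: L_def)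
  qed
  define dense where "dense D \<longleftrightarrow> emeasure lebesgue D < 2 * emeasure lebesgue (E \<inter> D)" for D
  define G where "G = {x. \<exists>n. dense (dyadic_cube L n x)}"
  have G [measurable]: "G \<in> sets lebesgue" and null: "emeasure lebesgue (E - G) = 0"
    using dyadic_density[of E L] L e by (auto simp: G_def dense_def)
  have "emeasure lebesgue (F \<inter> G) \<le> ennreal c * emeasure lebesgue (E \<inter> G)"
    unfolding G_def
  proof (rule emeasure_le_on_maximal_dyadic_cubes(2))
    fix n and x :: "real ^ 'n"
    assume dn: "dense (dyadic_cube L n x)" and nd: "\<And>m. m < n \<Longrightarrow> \<not> dense (dyadic_cube L m x)"
    have "n \<noteq> 0"
    proof
      assume "n = 0"
      have "2 * emeasure lebesgue (E \<inter> dyadic_cube L 0 x) \<le> 2 * emeasure lebesgue E"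
        by (intro mult_left_mono emeasure_mono) auto
      also have "\<dots> \<le> ennreal (L ^ CARD('n))"
        using L e by (auto simp: ennreal_leI simp flip: ennreal_mult ennreal_numeral)
      also have "\<dots> = emeasure lebesgue (dyadic_cube L 0 x)"
        by (rule dyadic_cube_subset_closed_cube[OF L(1), of 0 x]) simp
      finally show False using dn \<open>n = 0\<close> by (simp add: dense_def not_less)
    qed
    then obtain m where m: "n = Suc m" by (cases n) auto
    define V where "V = (L / 2 ^ m) ^ CARD('n)"
    obtain P where P: "is_cube P" "P \<in> sets lebesgue" "dyadic_cube L m x \<subseteq> P"
      "emeasure lebesgue P = ennreal V" "emeasure lebesgue (dyadic_cube L m x) = ennreal V"
      using dyadic_cube_subset_closed_cube[OF L(1), of m x] unfolding V_def by metis
    have [measurable]: "P \<in> sets lebesgue" by (fact P)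
    have V: "0 < V" using L by (simp add: V_def)
    have Vn: "emeasure lebesgue (dyadic_cube L n x) = ennreal (V / 2 ^ CARD('n))"
      by (rule dyadic_cube_subset_closed_cube[OF L(1), of n x])
        (simp add: V_def m power_divide power_mult_distrib mult.commute)
    have "emeasure lebesgue (P - dyadic_cube L m x) = 0"
      using P by (subst emeasure_Diff) auto
    then have "emeasure lebesgue (E \<inter> P) \<le> emeasure lebesgue (E \<inter> dyadic_cube L m x)"
      by (intro emeasure_mono_AE AE_I[where N = "P - dyadic_cube L m x"]) auto
    also have "2 * \<dots> \<le> ennreal V"
      using nd[of m] P by (simp add: m dense_def not_less)
    finally have half: "2 * emeasure lebesgue (E \<inter> P) \<le> ennreal V"
      by (simp add: mult_left_mono)
    have "emeasure lebesgue (F \<inter> dyadic_cube L n x) \<le> emeasure lebesgue (F \<inter> P)"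
      using P(3) dyadic_cube_antimono[of m n L x] by (intro emeasure_mono) (auto simp: m)
    also have "\<dots> \<le> ennreal (2 * k / a * V)"
      using bmo_cube_superlevel_le[OF u k a P(1,2,4) V, of s] half by (simp add: E_def F_def)
    also have "\<dots> = ennreal (c / 2) * ennreal (V / 2 ^ CARD('n))"
    proof -
      have "2 * k / a * V = c / 2 * (V / 2 ^ CARD('n))"
        by (simp add: c_def power_add)
      moreover have "ennreal (c / 2 * (V / 2 ^ CARD('n))) = ennreal (c / 2) * ennreal (V / 2 ^ CARD('n))"
        using c V by (intro ennreal_mult) auto
      ultimately show ?thesis by simp
    qed
    also have "\<dots> \<le> ennreal (c / 2) * (2 * emeasure lebesgue (E \<inter> dyadic_cube L n x))"
      using dn Vn by (intro mult_left_mono) (auto simp: dense_def)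
    also have "\<dots> = ennreal c * emeasure lebesgue (E \<inter> dyadic_cube L n x)"
    proof -
      have "ennreal (c / 2) * 2 = ennreal c"
        using c by (subst ennreal_numeral[symmetric], subst ennreal_mult[symmetric]) auto
      then show ?thesis by (simp only: mult.assoc[symmetric])
    qed
    finally show "emeasure lebesgue (F \<inter> dyadic_cube L n x)
      \<le> ennreal c * emeasure lebesgue (E \<inter> dyadic_cube L n x)" .
  qed auto
  also have "\<dots> \<le> ennreal c * emeasure lebesgue E"
    by (intro mult_left_mono emeasure_mono) auto
  finally have "emeasure lebesgue (F \<inter> G) \<le> ennreal c * emeasure lebesgue E" .
  moreover have "emeasure lebesgue F \<le> emeasure lebesgue (F \<inter> G)"
  proof -
    have "F \<subseteq> E" using a by (auto simp: E_def F_def)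
    then show ?thesis
      using null by (intro emeasure_mono_AE AE_I[where N = "E - G"]) auto
  qed
  ultimately show ?thesis
    by (simp add: E_def F_def c_def)
qed

lemma bmo_superlevel_iterate:
  fixes u :: "real ^ 'n \<Rightarrow> real"
  assumes u: "u \<in> borel_measurable lebesgue" and k: "bmo_norm u \<le> ennreal k" "0 \<le> k" and a: "0 < a"
    and fin: "emeasure lebesgue {x. s < \<bar>u x\<bar>} < \<infinity>"
  shows "emeasure lebesgue {x. s + real p * a < \<bar>u x\<bar>}
    \<le> ennreal ((2 ^ (CARD('n) + 2) * k / a) ^ p) * emeasure lebesgue {x. s < \<bar>u x\<bar>}"
proof (induction p)
  case (Suc p)
  define c where "c = 2 ^ (CARD('n) + 2) * k / a"
  have c: "0 \<le> c" using k a by (simp add: c_def)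
  have "emeasure lebesgue {x. s + real p * a < \<bar>u x\<bar>} < \<infinity>"
    using Suc.IH by (rule le_less_trans) (use fin in \<open>simp add: ennreal_mult_less_top\<close>)
  from bmo_superlevel_step[OF u k a this]
  have "emeasure lebesgue {x. s + real (Suc p) * a < \<bar>u x\<bar>}
      \<le> ennreal c * emeasure lebesgue {x. s + real p * a < \<bar>u x\<bar>}"
    by (simp add: c_def algebra_simps)
  also have "\<dots> \<le> ennreal c * (ennreal (c ^ p) * emeasure lebesgue {x. s < \<bar>u x\<bar>})"
    using Suc.IH by (intro mult_left_mono) (auto simp: c_def)
  also have "\<dots> = ennreal (c ^ Suc p) * emeasure lebesgue {x. s < \<bar>u x\<bar>}"
    using c by (simp add: ennreal_mult mult.assoc)
  finally show ?case by (simp add: c_def)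
qed simp

lemma bmo_superlevel_decay:
  fixes u :: "real ^ 'n \<Rightarrow> real"
  assumes u: "u \<in> borel_measurable lebesgue" and k: "bmo_norm u \<le> ennreal k" "0 < k"
    and fin: "emeasure lebesgue {x. k < \<bar>u x\<bar>} < \<infinity>" and p: "0 < p" and t: "k \<le> t"
  shows "emeasure lebesgue {x. t < \<bar>u x\<bar>}
    \<le> ennreal ((2 ^ (CARD('n) + 3) * real p * (k / t)) ^ p) * emeasure lebesgue {x. k < \<bar>u x\<bar>}"
proof (cases "t < 2 * k")
  case True
  have "{x. k < \<bar>u x\<bar>} \<in> sets lebesgue"
  proof -
    have "Measurable.pred lebesgue (\<lambda>x. k < \<bar>u x\<bar>)" using u by measurable
    then show ?thesis by (simp add: pred_def)
  qed
  then have "emeasure lebesgue {x. t < \<bar>u x\<bar>} \<le> 1 * emeasure lebesgue {x. k < \<bar>u x\<bar>}"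
    unfolding mult_1_left using t by (intro emeasure_mono) auto
  also have "\<dots> \<le> ennreal ((2 ^ (CARD('n) + 3) * real p * (k / t)) ^ p) * emeasure lebesgue {x. k < \<bar>u x\<bar>}"
  proof (intro mult_right_mono)
    have "1 \<le> 2 * (k / t)" using True k t by (simp add: field_simps)
    moreover have "(1::real) * 1 \<le> 2 ^ (CARD('n) + 2) * real p"
      using p by (intro mult_mono one_le_power) auto
    ultimately have "1 * 1 \<le> (2 ^ (CARD('n) + 2) * real p) * (2 * (k / t))"
      by (intro mult_mono) auto
    then have "1 \<le> (2 ^ (CARD('n) + 3) * real p * (k / t)) ^ p"
      by (intro one_le_power) (simp add: field_simps power_add)
    then show "1 \<le> ennreal ((2 ^ (CARD('n) + 3) * real p * (k / t)) ^ p)"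
      using ennreal_leI by fastforce
  qed simp
  finally show ?thesis .
next
  case False
  define a where "a = (t - k) / real p"
  have a: "0 < a" using False k p by (simp add: a_def)
  have "2 ^ (CARD('n) + 2) * k / a \<le> 2 ^ (CARD('n) + 3) * real p * (k / t)"
  proof -
    have "1 / (t - k) \<le> 2 / t"
      using False k by (simp add: field_simps)
    then have "(2 ^ (CARD('n) + 2) * k * real p) * (1 / (t - k)) \<le> (2 ^ (CARD('n) + 2) * k * real p) * (2 / t)"
      using k by (intro mult_left_mono) auto
    then show ?thesis by (simp add: a_def power_add mult_ac)
  qed
  then have "(2 ^ (CARD('n) + 2) * k / a) ^ p \<le> (2 ^ (CARD('n) + 3) * real p * (k / t)) ^ p"
    using k a by (intro power_mono) auto
  then have "ennreal ((2 ^ (CARD('n) + 2) * k / a) ^ p) * emeasure lebesgue {x. k < \<bar>u x\<bar>}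
      \<le> ennreal ((2 ^ (CARD('n) + 3) * real p * (k / t)) ^ p) * emeasure lebesgue {x. k < \<bar>u x\<bar>}"
    by (intro mult_right_mono ennreal_leI) auto
  moreover have "k + real p * a = t" using p by (simp add: a_def)
  ultimately show ?thesis
    using bmo_superlevel_iterate[OF u k(1) _ a fin, of p] k by (auto intro: order_trans)
qed

lemma bmo_norm_0_superlevel:
  assumes "u \<in> borel_measurable lebesgue" "bmo_norm u = 0" "emeasure lebesgue {x. 0 < \<bar>u x\<bar>} < \<infinity>" "0 < t"
  shows "emeasure lebesgue {x. t < \<bar>u x\<bar>} = 0"
  using bmo_superlevel_step[of u 0 t 0] assms by simp

section \<open>Lorentz quasi-norms\<close>

lemma epowr_mono: "0 < p \<Longrightarrow> x \<le> y \<Longrightarrow> epowr x p \<le> epowr y p"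
  by (auto simp: epowr_def top.extremum_unique less_top
      intro!: ennreal_leI powr_mono2 enn2real_mono)

lemma epowr_ennreal: "0 \<le> r \<Longrightarrow> epowr (ennreal r) p = ennreal (r powr p)"
  by (simp add: epowr_def)

lemma epowr_0 [simp]: "epowr 0 p = 0"
  by (simp add: epowr_def)

lemma epowr_top [simp]: "epowr top p = top"
  by (simp add: epowr_def)

lemma epowr_mult: "epowr (x * y) p = epowr x p * epowr y p"
proof (cases x; cases y)
  fix r s :: real assume "0 \<le> r" "x = ennreal r" "0 \<le> s" "y = ennreal s"
  then show ?thesis
    by (simp add: epowr_ennreal powr_mult flip: ennreal_mult)
qed (auto simp: ennreal_top_mult ennreal_mult_top epowr_ennreal)

lemma epowr_epowr: "epowr (epowr x p) r = epowr x (p * r)"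
  by (cases x) (auto simp: epowr_ennreal powr_powr)

lemma nn_integral_powr_from_0:
  assumes "0 < h" "0 \<le> T"
  shows "(\<integral>\<^sup>+t\<in>{0..T}. ennreal (t powr (h - 1)) \<partial>lborel) = ennreal (T powr h / h)"
  using nn_integral_has_integral_lebesgue'[OF _ has_integral_powr_from_0[of "h - 1" T]] assms
  by simp

lemma nn_integral_powr_to_inf:
  assumes "0 < h" "0 < T"
  shows "(\<integral>\<^sup>+t\<in>{T..}. ennreal (t powr (- h - 1)) \<partial>lborel) = ennreal (T powr (- h) / h)"
  using nn_integral_has_integral_lebesgue'[OF _ has_integral_powr_to_inf[of "- h - 1" T]] assms
  by simp

lemma lorentz_norm_lower:
  assumes q: "0 < q" and \<gamma>: "0 < \<gamma>" and k: "0 \<le> k"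
    and M: "\<And>t. 0 < t \<Longrightarrow> t < k powr q \<Longrightarrow> M \<le> emeasure lebesgue {x. \<bar>f x\<bar> powr q > t}"
  shows "ennreal k * epowr M (1 / q)
    \<le> ennreal (if \<gamma> = \<infinity> then 1 else (enn2real \<gamma> / q) powr (1 / enn2real \<gamma>)) * lorentz_norm q \<gamma> f"
proof (cases "\<gamma> = \<infinity>")
  case True
  define S where "S = (SUP t \<in> {0::real<..}. ennreal t * emeasure lebesgue {x. \<bar>f x\<bar> powr q > t})"
  have *: "ennreal t * M \<le> S" if "0 < t" "t < k powr q" for t
    unfolding S_def using that M[OF that]
    by (intro SUP_upper2[where i = t] mult_left_mono) auto
  have "ennreal (k powr q) * M \<le> S"
  proof (cases "k = 0")
    case False
    then have pos: "0 < k powr q" using k by simp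
    have "((\<lambda>t. ennreal t * M) \<longlongrightarrow> ennreal (k powr q) * M) (at_left (k powr q))"
      using pos by (intro tendsto_mult_ennreal tendsto_ennrealI tendsto_const tendsto_ident_at) auto
    moreover have "eventually (\<lambda>t. ennreal t * M \<le> S) (at_left (k powr q))"
      using * by (intro eventually_at_leftI[OF _ pos]) auto
    ultimately show ?thesis
      by (intro tendsto_upperbound) auto
  qed simp
  then have "epowr (ennreal (k powr q) * M) (1 / q) \<le> epowr S (1 / q)"
    using q by (intro epowr_mono) auto
  then show ?thesis
    using True q k by (simp add: lorentz_norm_def S_def epowr_mult epowr_ennreal powr_powr)
next
  case False
  define g where "g = enn2real \<gamma>"
  have g: "0 < g" using False \<gamma> by (simp add: g_def enn2real_positive_iff less_top)
  define h where "h = g / q"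
  have h: "0 < h" using g q by (simp add: h_def)
  define T where "T = k powr q"
  have T: "0 \<le> T" by (simp add: T_def)
  define J where "J = (\<integral>\<^sup>+t\<in>{0::real<..}. epowr (emeasure lebesgue {x. \<bar>f x\<bar> powr q > t}) h
      * ennreal (t powr (h - 1)) \<partial>lborel)"
  have "epowr M h * ennreal (T powr h / h) = (\<integral>\<^sup>+t. epowr M h * (ennreal (t powr (h - 1)) * indicator {0..T} t) \<partial>lborel)"
    using nn_integral_powr_from_0[OF h T] by (simp add: nn_integral_cmult)
  also have "\<dots> \<le> J"
    unfolding J_def
  proof (intro nn_integral_mono_AE)
    have "AE t in lborel. t \<noteq> 0 \<and> t \<noteq> T"
      by (intro AE_conjI AE_lborel_singleton)
    then show "AE t in lborel. epowr M h * (ennreal (t powr (h - 1)) * indicator {0..T} t)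
        \<le> epowr (emeasure lebesgue {x. \<bar>f x\<bar> powr q > t}) h * ennreal (t powr (h - 1)) * indicator {0<..} t"
    proof eventually_elim
      case (elim t)
      show ?case
      proof (cases "0 < t \<and> t < T")
        case True
        then have "epowr M h \<le> epowr (emeasure lebesgue {x. \<bar>f x\<bar> powr q > t}) h"
          using M h by (intro epowr_mono) (auto simp: T_def)
        with True show ?thesis
          by (simp add: mult_right_mono del: emeasure_completion)
      next
        case False
        with elim have "t \<notin> {0..T}" by auto
        then show ?thesis by simp
      qed
    qed
  qed
  finally have "epowr (epowr M h * ennreal (T powr h / h)) (1 / g) \<le> epowr J (1 / g)"
    using g by (intro epowr_mono) auto
  moreover have "epowr (epowr M h * ennreal (T powr h / h)) (1 / g)
      = ennreal (k / h powr (1 / g)) * epowr M (1 / q)"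
  proof -
    have "(T powr h / h) powr (1 / g) = (T powr h) powr (1 / g) / h powr (1 / g)"
      using h by (simp add: powr_divide)
    moreover have "(T powr h) powr (1 / g) = k"
      using k q g by (simp add: T_def powr_powr h_def)
    moreover have "0 \<le> T powr h / h" using h by simp
    moreover have "h * (1 / g) = 1 / q" using g by (simp add: h_def)
    ultimately show ?thesis
      by (simp only: epowr_mult epowr_epowr epowr_ennreal mult.commute)
  qed
  ultimately have "ennreal (h powr (1 / g)) * (ennreal (k / h powr (1 / g)) * epowr M (1 / q))
      \<le> ennreal (h powr (1 / g)) * epowr J (1 / g)"
    by (intro mult_left_mono) auto
  moreover have "ennreal (h powr (1 / g)) * ennreal (k / h powr (1 / g)) = ennreal k"
    using h k by (simp flip: ennreal_mult)
  ultimately show ?thesis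
    using False by (simp add: lorentz_norm_def J_def h_def g_def Let_def mult.assoc[symmetric])
qed

lemma lorentz_norm_upper:
  assumes q: "0 < q" and \<gamma>: "0 < \<gamma>" and k: "0 < k" and B: "1 \<le> B"
    and small: "\<And>t. 0 < t \<Longrightarrow> t < k powr q \<Longrightarrow> emeasure lebesgue {x. \<bar>f x\<bar> powr q > t} \<le> M"
    and large: "\<And>t. k powr q \<le> t \<Longrightarrow>
      emeasure lebesgue {x. \<bar>f x\<bar> powr q > t} \<le> ennreal (B * (k powr q / t)\<^sup>2) * M"
  shows "lorentz_norm q \<gamma> f
    \<le> ennreal (if \<gamma> = \<infinity> then B powr (1 / q)
        else ((1 + B powr (enn2real \<gamma> / q)) / (enn2real \<gamma> / q)) powr (1 / enn2real \<gamma>))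
      * (ennreal k * epowr M (1 / q))"
proof -
  define T where "T = k powr q"
  have T: "0 < T" using k by (simp add: T_def)
  show ?thesis
  proof (cases "\<gamma> = \<infinity>")
    case True
    define S where "S = (SUP t \<in> {0::real<..}. ennreal t * emeasure lebesgue {x. \<bar>f x\<bar> powr q > t})"
    have "S \<le> ennreal (B * T) * M"
      unfolding S_def
    proof (intro SUP_least)
      fix t :: real assume "t \<in> {0<..}"
      then have t: "0 < t" by simp
      show "ennreal t * emeasure lebesgue {x. \<bar>f x\<bar> powr q > t} \<le> ennreal (B * T) * M"
      proof (cases "t < T")
        case True
        have "1 * T \<le> B * T" using B T by (intro mult_right_mono) auto
        with True have "t \<le> B * T" by simp
        then show ?thesis
          using small[of t] True t by (intro mult_mono ennreal_leI) (auto simp: T_def)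
      next
        case False
        have "ennreal t * emeasure lebesgue {x. \<bar>f x\<bar> powr q > t} \<le> ennreal t * (ennreal (B * (T / t)\<^sup>2) * M)"
          using large[of t] False by (intro mult_left_mono) (auto simp: T_def)
        also have "\<dots> = ennreal (t * (B * (T / t)\<^sup>2)) * M"
          using t B by (simp add: ennreal_mult mult.assoc)
        also have "\<dots> \<le> ennreal (B * T) * M"
        proof (intro mult_right_mono ennreal_leI)
          have "T / t \<le> 1" using False t by simp
          then have "B * T * (T / t) \<le> B * T * 1" using B T by (intro mult_left_mono) auto
          then show "t * (B * (T / t)\<^sup>2) \<le> B * T"
            using t by (simp add: power2_eq_square field_simps)
        qed simp
        finally show ?thesis .
      qed
    qed
    then have "epowr S (1 / q) \<le> epowr (ennreal (B * T) * M) (1 / q)"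
      using q by (intro epowr_mono) auto
    also have "\<dots> = ennreal (B powr (1 / q)) * (ennreal k * epowr M (1 / q))"
      using B T q k by (simp add: epowr_mult epowr_ennreal powr_mult T_def powr_powr ennreal_mult mult.assoc)
    finally show ?thesis
      using True by (simp add: lorentz_norm_def S_def)
  next
    case False
    define g where "g = enn2real \<gamma>"
    have g: "0 < g" using False \<gamma> by (simp add: g_def enn2real_positive_iff less_top)
    define h where "h = g / q"
    have h: "0 < h" using g q by (simp add: h_def)
    define J where "J = (\<integral>\<^sup>+t\<in>{0::real<..}. epowr (emeasure lebesgue {x. \<bar>f x\<bar> powr q > t}) h
        * ennreal (t powr (h - 1)) \<partial>lborel)"
    have "J \<le> (\<integral>\<^sup>+t. epowr M h * (ennreal (t powr (h - 1)) * indicator {0..T} t)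
        + epowr M h * (ennreal (B powr h * T powr (2 * h)) * (ennreal (t powr (- h - 1)) * indicator {T..} t)) \<partial>lborel)"
      unfolding J_def
    proof (intro nn_integral_mono)
      fix t :: real
      consider "t \<le> 0" | "0 < t" "t < T" | "T \<le> t" "0 < t" using T by linarith
      then show "epowr (emeasure lebesgue {x. \<bar>f x\<bar> powr q > t}) h * ennreal (t powr (h - 1)) * indicator {0<..} t
        \<le> epowr M h * (ennreal (t powr (h - 1)) * indicator {0..T} t)
        + epowr M h * (ennreal (B powr h * T powr (2 * h)) * (ennreal (t powr (- h - 1)) * indicator {T..} t))"
      proof cases
        case 2
        then have "epowr (emeasure lebesgue {x. \<bar>f x\<bar> powr q > t}) h \<le> epowr M h"
          using small h by (intro epowr_mono) (auto simp: T_def)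
        with 2 show ?thesis
          by (simp add: mult_right_mono del: emeasure_completion)
      next
        case 3
        have "epowr (emeasure lebesgue {x. \<bar>f x\<bar> powr q > t}) h \<le> epowr (ennreal (B * (T / t)\<^sup>2) * M) h"
          using large[of t] 3 h by (intro epowr_mono) (auto simp: T_def)
        then have "epowr (emeasure lebesgue {x. \<bar>f x\<bar> powr q > t}) h * ennreal (t powr (h - 1))
          \<le> epowr (ennreal (B * (T / t)\<^sup>2) * M) h * ennreal (t powr (h - 1))"
          by (rule mult_right_mono) simp
        also have "\<dots> = epowr M h * ennreal ((B * (T / t)\<^sup>2) powr h * t powr (h - 1))"
        proof -
          have "0 \<le> B * (T / t)\<^sup>2" using B by simp
          then show ?thesis
            by (simp only: epowr_mult epowr_ennreal ennreal_mult powr_ge_zero mult_ac)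
        qed
        also have "(B * (T / t)\<^sup>2) powr h * t powr (h - 1) = B powr h * T powr (2 * h) * t powr (- h - 1)"
        proof -
          have "(T / t)\<^sup>2 = (T / t) powr 2" using T 3 by simp
          then have "((T / t)\<^sup>2) powr h = (T / t) powr (2 * h)"
            by (simp only: powr_powr)
          also have "\<dots> = T powr (2 * h) / t powr (2 * h)"
            using T 3 by (simp add: powr_divide)
          finally have "(B * (T / t)\<^sup>2) powr h * t powr (h - 1)
              = B powr h * (T powr (2 * h) / t powr (2 * h)) * t powr (h - 1)"
            by (simp only: powr_mult[of B])
          also have "\<dots> = B powr h * T powr (2 * h) * (t powr (h - 1) / t powr (2 * h))"
            by simp
          also have "t powr (h - 1) / t powr (2 * h) = t powr (- h - 1)"
            by (simp flip: powr_diff)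
          finally show ?thesis .
        qed
        finally show ?thesis
          using 3 B by (auto simp: indicator_def ennreal_mult add_increasing)
      qed auto
    qed
    also have "\<dots> = epowr M h * ennreal (T powr h / h)
        + epowr M h * (ennreal (B powr h * T powr (2 * h)) * ennreal (T powr (- h) / h))"
      using nn_integral_powr_from_0[OF h less_imp_le[OF T]] nn_integral_powr_to_inf[OF h T]
      by (simp add: nn_integral_cmult nn_integral_add)
    also have "\<dots> = epowr M h * ennreal (T powr h * ((1 + B powr h) / h))"
    proof -
      have "T powr (2 * h) * T powr (- h) = T powr h"
        by (simp flip: powr_add)
      then have "T powr h / h + B powr h * T powr (2 * h) * (T powr (- h) / h) = T powr h * ((1 + B powr h) / h)"
        by (simp add: field_simps add_divide_distrib)
      then show ?thesis
        using h by (simp flip: distrib_left ennreal_mult ennreal_plus)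
    qed
    finally have "epowr J (1 / g) \<le> epowr (epowr M h * ennreal (T powr h * ((1 + B powr h) / h))) (1 / g)"
      using g by (intro epowr_mono) auto
    also have "\<dots> = epowr M (1 / q) * ennreal (k * ((1 + B powr h) / h) powr (1 / g))"
    proof -
      have "(T powr h) powr (1 / g) = k" using k q g by (simp add: T_def powr_powr h_def)
      then have "(T powr h * ((1 + B powr h) / h)) powr (1 / g) = k * ((1 + B powr h) / h) powr (1 / g)"
        by (simp only: powr_mult)
      moreover have "0 \<le> T powr h * ((1 + B powr h) / h)" using h by simp
      moreover have "h * (1 / g) = 1 / q" using g by (simp add: h_def)
      ultimately show ?thesis
        by (simp only: epowr_mult epowr_epowr epowr_ennreal)
    qed
    also have "\<dots> = ennreal (((1 + B powr h) / h) powr (1 / g)) * (ennreal k * epowr M (1 / q))"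
      using k by (simp add: ennreal_mult mult_ac)
    finally show ?thesis
      using False by (simp add: lorentz_norm_def J_def h_def g_def Let_def)
  qed
qed

lemma lorentz_norm_eq_0:
  assumes "\<And>t. 0 < t \<Longrightarrow> emeasure lebesgue {x. \<bar>f x\<bar> powr q > t} = 0"
  shows "lorentz_norm q \<gamma> f = 0"
proof -
  have "(SUP t \<in> {0::real<..}. ennreal t * emeasure lebesgue {x. \<bar>f x\<bar> powr q > t}) = (SUP t \<in> {0::real<..}. 0)"
    using assms by (intro SUP_cong) (simp_all del: emeasure_completion)
  moreover have "(\<integral>\<^sup>+t\<in>{0::real<..}. epowr (emeasure lebesgue {x. \<bar>f x\<bar> powr q > t}) h
      * ennreal (t powr (h - 1)) \<partial>lborel) = (\<integral>\<^sup>+(t::real). 0 \<partial>lborel)" for h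
    using assms by (intro nn_integral_cong) (auto simp: indicator_def simp del: emeasure_completion)
  ultimately show ?thesis
    unfolding lorentz_norm_def Let_def by simp
qed

lemma superlevel_truncation:
  fixes u :: "'a \<Rightarrow> real"
  assumes "0 < q" "0 \<le> k" "0 \<le> t"
  shows "{x. \<bar>indicator {x. \<bar>u x\<bar> > k} x * u x\<bar> powr q > t} = {x. max k (t powr (1 / q)) < \<bar>u x\<bar>}"
proof -
  have "t < y powr q \<longleftrightarrow> t powr (1 / q) < y" if "0 < y" for y
  proof -
    have "t < y powr q \<longleftrightarrow> (t powr (1 / q)) powr q < y powr q"
      using assms by (simp add: powr_powr)
    also have "\<dots> \<longleftrightarrow> t powr (1 / q) < y"
      using that assms powr_less_mono2[of q "t powr (1 / q)" y] powr_mono2[of q y "t powr (1 / q)"]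
      by (auto simp: not_less[symmetric] simp del: powr_powr)
    finally show ?thesis .
  qed
  then show ?thesis
    using assms by (auto simp: indicator_def)
qed

theorem theorem1p5:
  fixes q :: real and \<gamma> :: ennreal
  assumes "0 < q" and "0 < \<gamma>"
  shows "\<exists>c1 c2 :: real. 0 < c1 \<and> 0 < c2 \<and>
    (\<forall>(u :: real ^ 'n \<Rightarrow> real) (k :: real).
       u \<in> bmo \<and> 0 \<le> k \<and> bmo_norm u \<le> ennreal k \<and>
       (k = 0 \<longrightarrow> emeasure lebesgue {x. \<bar>u x\<bar> > k} < \<infinity>) \<longrightarrow>
       ennreal k * epowr (emeasure lebesgue {x. \<bar>u x\<bar> > k}) (1 / q)
         \<le> ennreal c1 * lorentz_norm q \<gamma> (\<lambda>x. indicator {x. \<bar>u x\<bar> > k} x * u x) \<and>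
       lorentz_norm q \<gamma> (\<lambda>x. indicator {x. \<bar>u x\<bar> > k} x * u x)
         \<le> ennreal c2 * (ennreal k * epowr (emeasure lebesgue {x. \<bar>u x\<bar> > k}) (1 / q)))"
proof -
  obtain p0 :: nat where "2 * q \<le> real p0" using real_arch_simple by blast
  define p where "p = max 1 p0"
  have p: "0 < p" "2 * q \<le> real p" using \<open>2 * q \<le> real p0\<close> by (auto simp: p_def)
  define B :: real where "B = (2 ^ (CARD('n) + 3) * real p) ^ p"
  have "(1::real) * 1 \<le> 2 ^ (CARD('n) + 3) * real p"
    using p by (intro mult_mono one_le_power) auto
  then have B: "1 \<le> B" unfolding B_def by (intro one_le_power) simp
  define c1 where "c1 = (if \<gamma> = \<infinity> then 1 else (enn2real \<gamma> / q) powr (1 / enn2real \<gamma>))"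
  define c2 where "c2 = (if \<gamma> = \<infinity> then B powr (1 / q)
        else ((1 + B powr (enn2real \<gamma> / q)) / (enn2real \<gamma> / q)) powr (1 / enn2real \<gamma>))"
  have g: "0 < enn2real \<gamma>" if "\<gamma> \<noteq> \<infinity>"
    using assms that by (simp add: enn2real_positive_iff less_top)
  have c1: "0 < c1" using g assms by (auto simp: c1_def)
  have "0 < 1 + B powr (enn2real \<gamma> / q)" by (simp add: add_pos_nonneg)
  then have c2: "0 < c2" using g assms B by (auto simp: c2_def)
  have main: "ennreal k * epowr (emeasure lebesgue {x. \<bar>u x\<bar> > k}) (1 / q)
        \<le> ennreal c1 * lorentz_norm q \<gamma> (\<lambda>x. indicator {x. \<bar>u x\<bar> > k} x * u x) \<and>
      lorentz_norm q \<gamma> (\<lambda>x. indicator {x. \<bar>u x\<bar> > k} x * u x)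
        \<le> ennreal c2 * (ennreal k * epowr (emeasure lebesgue {x. \<bar>u x\<bar> > k}) (1 / q))"
    if "u \<in> bmo" and k: "0 \<le> k" and bmo: "bmo_norm u \<le> ennreal k"
      and fin0: "k = 0 \<longrightarrow> emeasure lebesgue {x. \<bar>u x\<bar> > k} < \<infinity>"
    for u :: "real ^ 'n \<Rightarrow> real" and k :: real
  proof -
    define M where "M = emeasure lebesgue {x. \<bar>u x\<bar> > k}"
    define f where "f = (\<lambda>x. indicator {x. \<bar>u x\<bar> > k} x * u x)"
    have u: "u \<in> borel_measurable lebesgue"
      using \<open>u \<in> bmo\<close> by (auto simp: bmo_def intro: loc_integrable_imp_measurable)
    have d: "{x. \<bar>f x\<bar> powr q > t} = {x. max k (t powr (1 / q)) < \<bar>u x\<bar>}" if "0 \<le> t" for t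
      unfolding f_def using that k assms by (intro superlevel_truncation)
    have small: "emeasure lebesgue {x. \<bar>f x\<bar> powr q > t} = M" if t: "0 < t" "t < k powr q" for t
    proof -
      have "t powr (1 / q) \<le> (k powr q) powr (1 / q)"
        using t assms by (intro powr_mono2) auto
      then have "t powr (1 / q) \<le> k"
        using k assms by (simp add: powr_powr)
      then show ?thesis
        using t by (simp only: d M_def max_absorb1 less_imp_le)
    qed
    have "ennreal k * epowr M (1 / q) \<le> ennreal c1 * lorentz_norm q \<gamma> f"
      unfolding c1_def
      using assms k small by (intro lorentz_norm_lower) simp_all
    moreover consider "k = 0" | "0 < k" "M = \<infinity>" | "0 < k" "M < \<infinity>"
      using k by (auto simp: less_top[symmetric] le_less)
    then have "lorentz_norm q \<gamma> f \<le> ennreal c2 * (ennreal k * epowr M (1 / q))"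
    proof cases
      case 1
      have "emeasure lebesgue {x. \<bar>f x\<bar> powr q > t} = 0" if "0 < t" for t
        using bmo_norm_0_superlevel[OF u, of "t powr (1 / q)"] bmo fin0 1 that
        by (simp add: d del: emeasure_completion)
      then have "lorentz_norm q \<gamma> f = 0" by (rule lorentz_norm_eq_0)
      then show ?thesis by simp
    next
      case 2
      then show ?thesis using c2 by (simp add: ennreal_mult_top)
    next
      case 3
      have "emeasure lebesgue {x. \<bar>f x\<bar> powr q > t} \<le> ennreal (B * (k powr q / t)\<^sup>2) * M"
        if t: "k powr q \<le> t" for t
      proof -
        define \<tau> where "\<tau> = t powr (1 / q)"
        have tpos: "0 < t" using t 3 by (simp add: less_le_trans[of 0 "k powr q"])
        have "(k powr q) powr (1 / q) \<le> \<tau>"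
          unfolding \<tau>_def using t assms by (intro powr_mono2) auto
        then have \<tau>: "k \<le> \<tau>" using k assms by (simp add: powr_powr)
        have "emeasure lebesgue {x. \<bar>f x\<bar> powr q > t} = emeasure lebesgue {x. \<tau> < \<bar>u x\<bar>}"
          using tpos \<tau> by (simp only: d max_absorb2 less_imp_le flip: \<tau>_def)
        also have "\<dots> \<le> ennreal ((2 ^ (CARD('n) + 3) * real p * (k / \<tau>)) ^ p) * M"
          unfolding M_def using u bmo 3 p \<tau> by (intro bmo_superlevel_decay) (simp_all add: M_def)
        also have "\<dots> \<le> ennreal (B * (k powr q / t)\<^sup>2) * M"
        proof (intro mult_right_mono ennreal_leI)
          have "(k / \<tau>) ^ p = (k / \<tau>) powr real p"
            using 3 \<tau> by (simp add: powr_realpow)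
          also have "\<dots> \<le> (k / \<tau>) powr (2 * q)"
            using 3 \<tau> p by (intro powr_mono') auto
          also have "\<dots> = ((k / \<tau>) powr q)\<^sup>2"
            using 3 \<tau> by (simp add: mult.commute power2_eq_square flip: powr_add)
          also have "(k / \<tau>) powr q = k powr q / t"
            using 3 \<tau> tpos assms by (simp add: powr_divide \<tau>_def powr_powr)
          finally show "(2 ^ (CARD('n) + 3) * real p * (k / \<tau>)) ^ p \<le> B * (k powr q / t)\<^sup>2"
            unfolding power_mult_distrib[of _ "k / \<tau>"] B_def using p by (intro mult_left_mono) auto
        qed simp
        finally show ?thesis .
      qed
      then show ?thesis
        unfolding c2_def using assms 3 B small by (intro lorentz_norm_upper) simp_all
    qed
    ultimately show ?thesis
      by (simp only: M_def f_def)
  qed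
  show ?thesis
    by (rule exI[of _ c1], rule exI[of _ c2], rule conjI[OF c1], rule conjI[OF c2],
        intro allI impI, elim conjE, rule main; assumption)
qed

end
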